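(* Let $T>0$, $\beta>0$, $\rho_\alpha>0$, let $\alpha_i\in\mathbb{R}$ be an unknown constant, let $f_i,g_i:\mathbb{R}\to\mathbb{R}$ be smooth functions with $g_i$ nowhere zero, and let $(x_{i,d}(k))_{k\ge 0}$ be a real sequence (the known desired trajectory). Consider the discrete-time scalar system $$x_i(k+1)=x_i(k)+T\alpha_i f_i(x_i(k))+T g_i(x_i(k))u_i(k),\qquad k\ge 0,$$ put $s_i(k)=x_i(k)-x_{i,d}(k)$, and let the system be driven by the equivalent control input $u_i(k)=u_{i,eq}(k)$, $$u_{i,eq}(k)=\frac{-1}{T g_i(x_i(k))}\Big(T\hat{\alpha}_i(k)f_i(x_i(k))+x_i(k)-x_{i,d}(k+1)+\beta s_i(k)\Big),$$ where $\hat\alpha_i(k)$ is the estimate of $\alpha_i$ at step $k$ and $\tilde\alpha_i(k)=\alpha_i-\hat\alpha_i(k)$ is the estimation error. Define $$V_i(k)=\tfrac12\big(s_i^2(k+1)+\beta s_i^2(k)\big)+\tfrac12\rho_\alpha\big(\tilde\alpha_i^2(k+1)+\beta\tilde\alpha_i^2(k)\big).$$ If the estimate is updated so that, for all $k\ge 0$, the adaptation law $$\tilde\alpha_i(k+1)=\tilde\alpha_i(k)-\frac{T s_i(k) f_i(x_i(k))}{\rho_\alpha}$$ holds, then for all $k\ge 0$ the difference $\Delta V_i(k)=V_i(k+1)-V_i(k)$ satisfies $$\Delta V_i(k)=-(\beta+1)\big(s_i^2(k+1)+\beta s_i^2(k)\big)+O\big(\Delta s_i^2(k),\,\Delta s_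i^2(k+1),\,\Delta\tilde\alpha_i^2(k),\,\Delta\tilde\alpha_i^2(k+1)\big).$$
   Context: Here $\Delta s_i(k)=s_i(k+1)-s_i(k)$, $\Delta\tilde\alpha_i(k)=\tilde\alpha_i(k+1)-\tilde\alpha_i(k)$, and $\Delta s_i^2(k)$, $\Delta\tilde\alpha_i^2(k)$ mean $(\Delta s_i(k))^2$, $(\Delta\tilde\alpha_i(k))^2$. The notation $O(a,b,c,d)$, for nonnegative $a,b,c,d$, denotes a term whose absolute value is at most $C(a+b+c+d)$, with a constant $C$ depending only on $\beta$ and $\rho_\alpha$ (in particular independent of $k$). $T$ is the sampling time, $\beta$ the second order sliding mode gain and $\rho_\alpha$ the adaptation gain. The index $i$ only indicates that all quantities are scalars. *)

theory Defs
  imports "HOL-Analysis.Derivative"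
begin

definition Delta :: "(nat \<Rightarrow> real) \<Rightarrow> nat \<Rightarrow> real"
  where "Delta a k = a (Suc k) - a k"

text \<open>Infinitely differentiable on the whole line; for each \<open>n\<close> the clause makes \<open>deriv\<close>
  at stage \<open>Suc n\<close> a genuine derivative.\<close>

definition smooth :: "(real \<Rightarrow> real) \<Rightarrow> bool"
  where "smooth f \<longleftrightarrow> (\<forall>n. (deriv ^^ n) f differentiable_on UNIV)"

definition tracking_error :: "(nat \<Rightarrow> real) \<Rightarrow> (nat \<Rightarrow> real) \<Rightarrow> nat \<Rightarrow> real"
  where "tracking_error x xd k = x k - xd k"

definition estimation_error :: "real \<Rightarrow> (nat \<Rightarrow> real) \<Rightarrow> nat \<Rightarrow> real"
  where "estimation_error \<alpha> \<alpha>hat k = \<alpha> - \<alpha>hat k"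

definition plant ::
  "real \<Rightarrow> real \<Rightarrow> (real \<Rightarrow> real) \<Rightarrow> (real \<Rightarrow> real) \<Rightarrow> (nat \<Rightarrow> real) \<Rightarrow> (nat \<Rightarrow> real) \<Rightarrow> bool"
  where "plant T \<alpha> f g u x \<longleftrightarrow>
    (\<forall>k. x (Suc k) = x k + T * \<alpha> * f (x k) + T * g (x k) * u k)"

definition equivalent_control ::
  "real \<Rightarrow> real \<Rightarrow> (real \<Rightarrow> real) \<Rightarrow> (real \<Rightarrow> real) \<Rightarrow> (nat \<Rightarrow> real) \<Rightarrow> (nat \<Rightarrow> real) \<Rightarrow>
    (nat \<Rightarrow> real) \<Rightarrow> nat \<Rightarrow> real"
  where "equivalent_control T \<beta> f g \<alpha>hat xd x k =
    (- 1 / (T * g (x k))) *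
      (T * \<alpha>hat k * f (x k) + x k - xd (Suc k) + \<beta> * tracking_error x xd k)"

definition adaptation_law ::
  "real \<Rightarrow> real \<Rightarrow> (real \<Rightarrow> real) \<Rightarrow> (nat \<Rightarrow> real) \<Rightarrow> (nat \<Rightarrow> real) \<Rightarrow> (nat \<Rightarrow> real) \<Rightarrow> bool"
  where "adaptation_law T \<rho> f x s err \<longleftrightarrow>
    (\<forall>k. err (Suc k) = err k - T * s k * f (x k) / \<rho>)"

definition lyapunov ::
  "real \<Rightarrow> real \<Rightarrow> (nat \<Rightarrow> real) \<Rightarrow> (nat \<Rightarrow> real) \<Rightarrow> nat \<Rightarrow> real"
  where "lyapunov \<beta> \<rho> s err k =
    1 / 2 * ((s (Suc k))\<^sup>2 + \<beta> * (s k)\<^sup>2) +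
    1 / 2 * \<rho> * ((err (Suc k))\<^sup>2 + \<beta> * (err k)\<^sup>2)"

end

theory Submission imports Defs begin

text \<open>
  The weighted energy \<open>W k = (s k)\<^sup>2 / 2 + \<rho> * (err k)\<^sup>2 / 2\<close> generates the Lyapunov
  function, since \<open>V k = W (k + 1) + \<beta> * W k\<close>; hence it suffices to follow \<open>W\<close> over one step.
  The equivalent control cancels the known part of the dynamics and leaves the linear recursion
  \<open>s (k + 1) = err k * \<phi> - \<beta> * s k\<close> with the regressor \<open>\<phi> = T * f (x k)\<close>.
  By \<open>a\<^sup>2 - b\<^sup>2 = 2 * b * (a - b) + (a - b)\<^sup>2\<close>, the change of \<open>W\<close> consists of first-order terms and
  half the (weighted) squared increments. The first-order terms contain the
  cross term \<open>s k * err k * \<phi>\<close> once with each sign: the adaptation law is chosen exactly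
  so that the unknown parameter drops out. What is left is \<open>- (\<beta> + 1) * (s k)\<^sup>2\<close> and the squared
  increments (lemma \<open>energy_step\<close>). Adding the identity at step \<open>k + 1\<close> to \<open>\<beta>\<close> times the identity
  at step \<open>k\<close> gives the claim, with an explicit remainder that is a linear combination of the four
  squared increments whose coefficients involve only \<open>\<beta>\<close> and \<open>\<rho>\<close>.
\<close>

text \<open>The control input divides by \<open>T * g (x k)\<close>, which the plant multiplies back; the terms in
  \<open>x k\<close> and the desired trajectory cancel, and the parameter enters only through its
  estimation error.\<close>

lemma closed_loop_tracking_error:
  assumes "T \<noteq> 0" and "\<And>y. g y \<noteq> 0"
    and "plant T \<alpha> f g u x"
    and "\<And>k. u k = equivalent_control T \<beta> f g \<alpha>hat xd x k"
  shows "tracking_error x xd (Suc k) =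
    estimation_error \<alpha> \<alpha>hat k * (T * f (x k)) - \<beta> * tracking_error x xd k"
proof -
  have "T * g (x k) * u k =
      - (T * \<alpha>hat k * f (x k) + x k - xd (Suc k) + \<beta> * tracking_error x xd k)"
    using assms(1,2) by (simp add: assms(4) equivalent_control_def)
  moreover have "x (Suc k) = x k + T * \<alpha> * f (x k) + T * g (x k) * u k"
    using assms(3) by (simp add: plant_def)
  ultimately show ?thesis
    by (simp add: tracking_error_def estimation_error_def algebra_simps)
qed

text \<open>Here \<open>s, s'\<close> and \<open>e, e'\<close> are consecutive tracking and estimation errors. To first order
  the tracking part contributes \<open>s * (s' - s) = s * e * \<phi> - (\<beta> + 1) * s\<^sup>2\<close> and the estimation
  part contributes \<open>\<rho> * e * (e' - e) = - s * e * \<phi>\<close>.\<close>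

lemma energy_step:
  fixes s s' e e' \<phi> \<beta> \<rho> :: real
  assumes tracking: "s' = e * \<phi> - \<beta> * s"
    and adaptation: "\<rho> * (e' - e) = - s * \<phi>"
  shows "(s'\<^sup>2 / 2 + \<rho> * e'\<^sup>2 / 2) - (s\<^sup>2 / 2 + \<rho> * e\<^sup>2 / 2) =
    - (\<beta> + 1) * s\<^sup>2 + (s' - s)\<^sup>2 / 2 + \<rho> * (e' - e)\<^sup>2 / 2"
proof -
  have "(s'\<^sup>2 / 2 + \<rho> * e'\<^sup>2 / 2) - (s\<^sup>2 / 2 + \<rho> * e\<^sup>2 / 2) =
      s * (s' - s) + e * (\<rho> * (e' - e)) + (s' - s)\<^sup>2 / 2 + \<rho> * (e' - e)\<^sup>2 / 2"
    by (simp add: power2_eq_square field_simps)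
  moreover have "s * (s' - s) + e * (\<rho> * (e' - e)) = - (\<beta> + 1) * s\<^sup>2"
    unfolding adaptation by (simp add: tracking power2_eq_square algebra_simps)
  ultimately show ?thesis
    by simp
qed

lemma Delta_lyapunov_eq:
  fixes s err \<phi> :: "nat \<Rightarrow> real"
  assumes "\<And>k. s (Suc k) = err k * \<phi> k - \<beta> * s k"
    and "\<And>k. \<rho> * (err (Suc k) - err k) = - s k * \<phi> k"
  shows "Delta (lyapunov \<beta> \<rho> s err) k = - (\<beta> + 1) * ((s (Suc k))\<^sup>2 + \<beta> * (s k)\<^sup>2) +
    (1 / 2 * ((Delta s (Suc k))\<^sup>2 + \<beta> * (Delta s k)\<^sup>2) +
     \<rho> / 2 * ((Delta err (Suc k))\<^sup>2 + \<beta> * (Delta err k)\<^sup>2))"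
proof -
  define W where "W j = (s j)\<^sup>2 / 2 + \<rho> * (err j)\<^sup>2 / 2" for j
  have step: "W (Suc j) - W j =
      - (\<beta> + 1) * (s j)\<^sup>2 + (Delta s j)\<^sup>2 / 2 + \<rho> * (Delta err j)\<^sup>2 / 2" for j
    unfolding W_def Delta_def using assms by (rule energy_step)
  have "lyapunov \<beta> \<rho> s err j = W (Suc j) + \<beta> * W j" for j
    by (simp add: lyapunov_def W_def field_simps)
  then have "Delta (lyapunov \<beta> \<rho> s err) k =
      (W (Suc (Suc k)) - W (Suc k)) + \<beta> * (W (Suc k) - W k)"
    by (simp add: Delta_def algebra_simps)
  then show ?thesis
    unfolding step by (simp add: field_simps)
qed

text \<open>The constant \<open>(1 + \<beta>) * (1 + \<rho>)\<close> dominates all four coefficients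
  \<open>1 / 2\<close>, \<open>\<beta> / 2\<close>, \<open>\<rho> / 2\<close> and \<open>\<rho> * \<beta> / 2\<close>, because each of them is half of one term of its
  expansion.\<close>

lemma abs_remainder_le:
  fixes \<beta> \<rho> a b c d :: real
  assumes "\<beta> \<ge> 0" "\<rho> \<ge> 0" "a \<ge> 0" "b \<ge> 0" "c \<ge> 0" "d \<ge> 0"
  shows "\<bar>1 / 2 * (b + \<beta> * a) + \<rho> / 2 * (d + \<beta> * c)\<bar>
    \<le> (1 + \<beta>) * (1 + \<rho>) * (a + b + c + d)"
proof -
  let ?C = "(1 + \<beta>) * (1 + \<rho>)"
  have "0 \<le> \<rho> * \<beta>"
    using assms by simp
  then have "\<beta> / 2 \<le> ?C" "1 / 2 \<le> ?C" "\<rho> * \<beta> / 2 \<le> ?C" "\<rho> / 2 \<le> ?C"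
    using assms by (simp_all add: algebra_simps)
  then have "\<beta> / 2 * a + 1 / 2 * b + \<rho> * \<beta> / 2 * c + \<rho> / 2 * d \<le> ?C * a + ?C * b + ?C * c + ?C * d"
    using assms by (intro add_mono mult_right_mono)
  moreover have "1 / 2 * (b + \<beta> * a) + \<rho> / 2 * (d + \<beta> * c) =
      \<beta> / 2 * a + 1 / 2 * b + \<rho> * \<beta> / 2 * c + \<rho> / 2 * d"
    by (simp add: field_simps)
  moreover have "0 \<le> 1 / 2 * (b + \<beta> * a) + \<rho> / 2 * (d + \<beta> * c)"
    using assms by simp
  ultimately show ?thesis
    by (simp only: distrib_left abs_of_nonneg)
qed

theorem proposition1:
  fixes \<beta> \<rho> :: real
  assumes "\<beta> > 0" and "\<rho> > 0"
  shows "\<exists>C>0. \<forall>(T::real) (\<alpha>::real) (f::real \<Rightarrow> real) (g::real \<Rightarrow> real) (xd::nat \<Rightarrow> real)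
      (x::nat \<Rightarrow> real) (u::nat \<Rightarrow> real) (\<alpha>hat::nat \<Rightarrow> real) (s::nat \<Rightarrow> real) (err::nat \<Rightarrow> real).
    T > 0 \<longrightarrow> smooth f \<longrightarrow> smooth g \<longrightarrow> (\<forall>y. g y \<noteq> 0) \<longrightarrow>
    s = tracking_error x xd \<longrightarrow>
    err = estimation_error \<alpha> \<alpha>hat \<longrightarrow>
    plant T \<alpha> f g u x \<longrightarrow>
    (\<forall>k. u k = equivalent_control T \<beta> f g \<alpha>hat xd x k) \<longrightarrow>
    adaptation_law T \<rho> f x s err \<longrightarrow>
    (\<forall>k. \<exists>r.
      Delta (lyapunov \<beta> \<rho> s err) k = - (\<beta> + 1) * ((s (Suc k))\<^sup>2 + \<beta> * (s k)\<^sup>2) + r \<and>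
      \<bar>r\<bar> \<le> C * ((Delta s k)\<^sup>2 + (Delta s (Suc k))\<^sup>2 + (Delta err k)\<^sup>2 + (Delta err (Suc k))\<^sup>2))"
proof (rule exI[of _ "(1 + \<beta>) * (1 + \<rho>)"], intro conjI allI impI)
  show "(1 + \<beta>) * (1 + \<rho>) > 0"
    using assms by simp
next
  fix T \<alpha> :: real and f g :: "real \<Rightarrow> real" and xd x u \<alpha>hat s err :: "nat \<Rightarrow> real" and k :: nat
  assume "T > 0" and "\<forall>y. g y \<noteq> 0"
    and s: "s = tracking_error x xd" and err: "err = estimation_error \<alpha> \<alpha>hat"
    and "plant T \<alpha> f g u x"
    and "\<forall>k. u k = equivalent_control T \<beta> f g \<alpha>hat xd x k"
    and adaptation: "adaptation_law T \<rho> f x s err"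
  define r where "r = 1 / 2 * ((Delta s (Suc k))\<^sup>2 + \<beta> * (Delta s k)\<^sup>2) +
    \<rho> / 2 * ((Delta err (Suc k))\<^sup>2 + \<beta> * (Delta err k)\<^sup>2)"
  have "s (Suc j) = err j * (T * f (x j)) - \<beta> * s j" for j
    unfolding s err
    by (rule closed_loop_tracking_error[where g = g and u = u])
      (use \<open>T > 0\<close> \<open>\<forall>y. g y \<noteq> 0\<close> \<open>plant T \<alpha> f g u x\<close>
        \<open>\<forall>k. u k = equivalent_control T \<beta> f g \<alpha>hat xd x k\<close> in auto)
  moreover have "\<rho> * (err (Suc j) - err j) = - s j * (T * f (x j))" for j
  proof -
    have "err (Suc j) - err j = - (T * s j * f (x j) / \<rho>)"
      using adaptation by (simp add: adaptation_law_def)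
    then show ?thesis
      using \<open>\<rho> > 0\<close> by simp
  qed
  ultimately have "Delta (lyapunov \<beta> \<rho> s err) k =
      - (\<beta> + 1) * ((s (Suc k))\<^sup>2 + \<beta> * (s k)\<^sup>2) + r"
    unfolding r_def by (rule Delta_lyapunov_eq)
  moreover have "\<bar>r\<bar> \<le> (1 + \<beta>) * (1 + \<rho>) *
      ((Delta s k)\<^sup>2 + (Delta s (Suc k))\<^sup>2 + (Delta err k)\<^sup>2 + (Delta err (Suc k))\<^sup>2)"
    unfolding r_def by (rule abs_remainder_le) (use assms in auto)
  ultimately show "\<exists>r.
      Delta (lyapunov \<beta> \<rho> s err) k = - (\<beta> + 1) * ((s (Suc k))\<^sup>2 + \<beta> * (s k)\<^sup>2) + r \<and>
      \<bar>r\<bar> \<le> (1 + \<beta>) * (1 + \<rho>) *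
        ((Delta s k)\<^sup>2 + (Delta s (Suc k))\<^sup>2 + (Delta err k)\<^sup>2 + (Delta err (Suc k))\<^sup>2)"
    by blast
qed

end
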